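(* (i) Let $M\xrightarrow{P}A$ be a relative averaging algebra. Then the vector space $M$ carries a diassociative algebra structure (denoted $M_P$) with the bilinear operations $$u\dashv_Pv:=u\cdot_MP(v)\quad\text{and}\quad u\vdash_Pv:=P(u)\cdot_Mv,\qquad u,v\in M.$$ (ii) Let $M\xrightarrow{P}A$ and $M'\xrightarrow{P'}A'$ be two relative averaging algebras and $(\varphi,\psi)$ a morphism between them. Then $\psi:M\to M'$ is a morphism of diassociative algebras from $M_P$ to $M'_{P'}$.
   Context: Vector spaces are over a field of characteristic $0$; associative algebras are not assumed unital. A relative averaging algebra $M\xrightarrow{P}A$ consists of an associative algebra $A$, an $A$-bimodule $M$ (both actions written $\cdot_M$) and a relative averaging operator $P:M\to A$, i.e. a linear map with $P(u)\cdot P(v)=P(P(u)\cdot_Mv)=P(u\cdot_MP(v))$ for all $u,v\in M$. A morphism from $M\xrightarrow{P}A$ to $M'\xrightarrow{P'}A'$ is a pair $(\varphi,\psi)$ of an algebra morphism $\varphi:A\to A'$ and a linear map $\psi:M\to M'$ with $\psi(a\cdot_Mu)=\varphi(a)\cdot_{M'}\psi(u)$, $\psi(u\cdot_Ma)=\psi(u)\cdot_{M'}\varphi(a)$ and $\varphi\circ P=P'\circ\psi$. A diassociative algebra is a vector space $D$ with bilinear operations $\dashv,\vdash$ satisfying $(a\dashv b)\dashv c=a\dashv(b\dashv c)=a\dashv(b\vdash c)$, $(a\vdash b)\dashv c=a\vdash(b\dashv c)$, $(a\dashv b)\vdash c=(a\vdash b)\vdash c=a\vdash(b\vdash c)$.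 Morphisms are linear maps preserving both operations. *)

theory Defs
  imports Complex_Main
begin

text \<open>
  Vector spaces are given by a scalar multiplication on a whole type, as in
  \<^locale>\<open>vector_space\<close>. The constant \<^const>\<open>Vector_Spaces.linear\<close> is written
  with its qualifier because the short name is reserved for real scalars.
\<close>

locale bilinear_map =
  X: vector_space sX + Y: vector_space sY + Z: vector_space sZ
  for sX :: "'k::field \<Rightarrow> 'x::ab_group_add \<Rightarrow> 'x"
    and sY :: "'k \<Rightarrow> 'y::ab_group_add \<Rightarrow> 'y"
    and sZ :: "'k \<Rightarrow> 'z::ab_group_add \<Rightarrow> 'z" +
  fixes b :: "'x \<Rightarrow> 'y \<Rightarrow> 'z"
  assumes linear_left: "\<And>y. Vector_Spaces.linear sX sZ (\<lambda>x. b x y)"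
    and linear_right: "\<And>x. Vector_Spaces.linear sY sZ (b x)"

text \<open>
  The class \<^class>\<open>ring\<close> has an associative product and no unit, so this is a
  not necessarily unital associative algebra.
\<close>

locale assoc_algebra =
  vector_space sA + mult: bilinear_map sA sA sA "(*)"
  for sA :: "'k::field_char_0 \<Rightarrow> 'a::ring \<Rightarrow> 'a"

locale assoc_algebra_morphism =
  A: assoc_algebra sA + A': assoc_algebra sA' + Vector_Spaces.linear sA sA' \<phi>
  for sA :: "'k::field_char_0 \<Rightarrow> 'a::ring \<Rightarrow> 'a"
    and sA' :: "'k \<Rightarrow> 'a'::ring \<Rightarrow> 'a'"
    and \<phi> :: "'a \<Rightarrow> 'a'" +
  assumes map_mult: "\<phi> (a * b) = \<phi> a * \<phi> b"

text \<open>\<open>l a u\<close> is the left action of \<open>a\<close> on \<open>u\<close>, and \<open>r u a\<close> the right action.\<close>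

locale bimodule =
  A: assoc_algebra sA + M: vector_space sM +
  l: bilinear_map sA sM sM l + r: bilinear_map sM sA sM r
  for sA :: "'k::field_char_0 \<Rightarrow> 'a::ring \<Rightarrow> 'a"
    and sM :: "'k \<Rightarrow> 'm::ab_group_add \<Rightarrow> 'm"
    and l :: "'a \<Rightarrow> 'm \<Rightarrow> 'm"
    and r :: "'m \<Rightarrow> 'a \<Rightarrow> 'm" +
  assumes left_action: "l (a * b) u = l a (l b u)"
    and middle_action: "r (l a u) b = l a (r u b)"
    and right_action: "r u (a * b) = r (r u a) b"

locale relative_averaging_algebra =
  bimodule sA sM l r + P: Vector_Spaces.linear sM sA P
  for sA :: "'k::field_char_0 \<Rightarrow> 'a::ring \<Rightarrow> 'a"
    and sM :: "'k \<Rightarrow> 'm::ab_group_add \<Rightarrow> 'm"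
    and l :: "'a \<Rightarrow> 'm \<Rightarrow> 'm"
    and r :: "'m \<Rightarrow> 'a \<Rightarrow> 'm"
    and P :: "'m \<Rightarrow> 'a" +
  assumes averaging_left: "P u * P v = P (l (P u) v)"
    and averaging_right: "P u * P v = P (r u (P v))"

locale relative_averaging_morphism =
  dom: relative_averaging_algebra sA sM l r P +
  cod: relative_averaging_algebra sA' sM' l' r' P' +
  \<phi>: assoc_algebra_morphism sA sA' \<phi> +
  \<psi>: Vector_Spaces.linear sM sM' \<psi>
  for sA :: "'k::field_char_0 \<Rightarrow> 'a::ring \<Rightarrow> 'a"
    and sM :: "'k \<Rightarrow> 'm::ab_group_add \<Rightarrow> 'm"
    and l :: "'a \<Rightarrow> 'm \<Rightarrow> 'm"
    and r :: "'m \<Rightarrow> 'a \<Rightarrow> 'm"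
    and P :: "'m \<Rightarrow> 'a"
    and sA' :: "'k \<Rightarrow> 'a'::ring \<Rightarrow> 'a'"
    and sM' :: "'k \<Rightarrow> 'm'::ab_group_add \<Rightarrow> 'm'"
    and l' :: "'a' \<Rightarrow> 'm' \<Rightarrow> 'm'"
    and r' :: "'m' \<Rightarrow> 'a' \<Rightarrow> 'm'"
    and P' :: "'m' \<Rightarrow> 'a'"
    and \<phi> :: "'a \<Rightarrow> 'a'"
    and \<psi> :: "'m \<Rightarrow> 'm'" +
  assumes map_left: "\<psi> (l a u) = l' (\<phi> a) (\<psi> u)"
    and map_right: "\<psi> (r u a) = r' (\<psi> u) (\<phi> a)"
    and intertwine: "\<phi> \<circ> P = P' \<circ> \<psi>"

locale diassociative_algebra =
  vector_space sD +
  dashv: bilinear_map sD sD sD dashv + vdash: bilinear_map sD sD sD vdash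
  for sD :: "'k::field_char_0 \<Rightarrow> 'd::ab_group_add \<Rightarrow> 'd"
    and dashv :: "'d \<Rightarrow> 'd \<Rightarrow> 'd" (infixl \<open>\<stileturn>\<close> 70)
    and vdash :: "'d \<Rightarrow> 'd \<Rightarrow> 'd" (infixl \<open>\<turnstile>\<close> 70) +
  assumes dashv_dashv: "(a \<stileturn> b) \<stileturn> c = a \<stileturn> (b \<stileturn> c)"
    and dashv_vdash: "a \<stileturn> (b \<stileturn> c) = a \<stileturn> (b \<turnstile> c)"
    and vdash_dashv: "(a \<turnstile> b) \<stileturn> c = a \<turnstile> (b \<stileturn> c)"
    and dashv_then_vdash: "(a \<stileturn> b) \<turnstile> c = (a \<turnstile> b) \<turnstile> c"
    and vdash_vdash: "(a \<turnstile> b) \<turnstile> c = a \<turnstile> (b \<turnstile> c)"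

locale diassociative_morphism =
  dom: diassociative_algebra sD dashv vdash +
  cod: diassociative_algebra sD' dashv' vdash' +
  Vector_Spaces.linear sD sD' f
  for sD :: "'k::field_char_0 \<Rightarrow> 'd::ab_group_add \<Rightarrow> 'd"
    and dashv :: "'d \<Rightarrow> 'd \<Rightarrow> 'd"
    and vdash :: "'d \<Rightarrow> 'd \<Rightarrow> 'd"
    and sD' :: "'k \<Rightarrow> 'e::ab_group_add \<Rightarrow> 'e"
    and dashv' :: "'e \<Rightarrow> 'e \<Rightarrow> 'e"
    and vdash' :: "'e \<Rightarrow> 'e \<Rightarrow> 'e"
    and f :: "'d \<Rightarrow> 'e" +
  assumes map_dashv: "f (dashv a b) = dashv' (f a) (f b)"
    and map_vdash: "f (vdash a b) = vdash' (f a) (f b)"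

definition dashv_of :: "('m \<Rightarrow> 'a \<Rightarrow> 'm) \<Rightarrow> ('m \<Rightarrow> 'a) \<Rightarrow> 'm \<Rightarrow> 'm \<Rightarrow> 'm"
  where "dashv_of r P u v = r u (P v)"

definition vdash_of :: "('a \<Rightarrow> 'm \<Rightarrow> 'm) \<Rightarrow> ('m \<Rightarrow> 'a) \<Rightarrow> 'm \<Rightarrow> 'm \<Rightarrow> 'm"
  where "vdash_of l P u v = l (P u) v"

end

theory Submission
  imports Defs
begin

text \<open>The two products on \<open>M\<close> are the bimodule actions pulled back along the
  linear map \<open>P\<close>, so they are bilinear. The averaging identities say that
  \<open>P\<close> sends both products of \<open>u\<close> and \<open>v\<close> to
  \<open>P u * P v\<close>. Hence an inner product that is acted with through \<open>P\<close>
  becomes a product in the algebra, and the diassociative laws reduce to the three bimodule axioms.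
  A morphism carries actions to actions and intertwines \<open>P\<close> with \<open>P'\<close>, so
  it respects the pulled-back products.\<close>

lemma (in bilinear_map) bilinear_map_precompose_left:
  assumes "Vector_Spaces.linear sW sX f"
  shows "bilinear_map sW sY sZ (\<lambda>w. b (f w))"
proof -
  interpret f: Vector_Spaces.linear sW sX f by fact
  show ?thesis
  proof (intro bilinear_map.intro bilinear_map_axioms.intro
      f.vs1.vector_space_axioms Y.vector_space_axioms Z.vector_space_axioms)
    show "Vector_Spaces.linear sW sZ (\<lambda>w. b (f w) y)" for y
      using Vector_Spaces.linear_compose[OF assms linear_left] by (simp add: comp_def)
  qed (rule linear_right)
qed

lemma (in bilinear_map) bilinear_map_precompose_right:
  assumes "Vector_Spaces.linear sW sY g"
  shows "bilinear_map sX sW sZ (\<lambda>x w. b x (g w))"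
proof -
  interpret g: Vector_Spaces.linear sW sY g by fact
  show ?thesis
  proof (intro bilinear_map.intro bilinear_map_axioms.intro
      X.vector_space_axioms g.vs1.vector_space_axioms Z.vector_space_axioms)
    show "Vector_Spaces.linear sW sZ (\<lambda>w. b x (g w))" for x
      using Vector_Spaces.linear_compose[OF assms linear_right] by (simp add: comp_def)
  qed (rule linear_left)
qed

lemma (in relative_averaging_algebra) diassociative_algebra_of:
  "diassociative_algebra sM (dashv_of r P) (vdash_of l P)"
proof -
  \<comment> \<open>Equations between functions, shaped like the conclusions of the two
    precomposition lemmas.\<close>
  have "dashv_of r P = (\<lambda>u v. r u (P v))" "vdash_of l P = (\<lambda>u. l (P u))"
    by (simp_all add: fun_eq_iff dashv_of_def vdash_of_def)
  then have "bilinear_map sM sM sM (dashv_of r P)" "bilinear_map sM sM sM (vdash_of l P)"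
    using r.bilinear_map_precompose_right l.bilinear_map_precompose_left P.linear_axioms
    by simp_all
  then show ?thesis
    \<comment> \<open>Read from right to left, the averaging identities bring \<open>P\<close> of
      either product to the normal form \<open>P u * P v\<close>; the outer action of that product
      is then split by \<open>left_action\<close> or \<open>right_action\<close>. The mixed law
      \<open>vdash_dashv\<close> is \<open>middle_action\<close> itself.\<close>
    by (intro diassociative_algebra.intro diassociative_algebra_axioms.intro M.vector_space_axioms)
      (simp_all add: dashv_of_def vdash_of_def left_action middle_action right_action
        flip: averaging_left averaging_right)
qed

lemma (in relative_averaging_morphism) diassociative_morphism_of:
  "diassociative_morphism sM (dashv_of r P) (vdash_of l P) sM' (dashv_of r' P') (vdash_of l' P') \<psi>"
proof -
  \<comment> \<open>Equivariance of \<open>\<psi>\<close> leaves the scalar argument as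
    \<open>\<phi> (P u)\<close>; this turns it into the \<open>P' (\<psi> u)\<close> that the target
    product requires.\<close>
  have "\<phi> (P u) = P' (\<psi> u)" for u
    using fun_cong[OF intertwine] by simp
  then show ?thesis
    by (intro diassociative_morphism.intro diassociative_morphism_axioms.intro
        dom.diassociative_algebra_of cod.diassociative_algebra_of \<psi>.linear_axioms)
      (simp_all add: dashv_of_def vdash_of_def map_left map_right)
qed

theorem proposition3p17:
  fixes sA :: "'k::field_char_0 \<Rightarrow> 'a::ring \<Rightarrow> 'a"
    and sM :: "'k \<Rightarrow> 'm::ab_group_add \<Rightarrow> 'm"
    and l :: "'a \<Rightarrow> 'm \<Rightarrow> 'm"
    and r :: "'m \<Rightarrow> 'a \<Rightarrow> 'm"
    and P :: "'m \<Rightarrow> 'a"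
    and sA' :: "'k \<Rightarrow> 'a'::ring \<Rightarrow> 'a'"
    and sM' :: "'k \<Rightarrow> 'm'::ab_group_add \<Rightarrow> 'm'"
    and l' :: "'a' \<Rightarrow> 'm' \<Rightarrow> 'm'"
    and r' :: "'m' \<Rightarrow> 'a' \<Rightarrow> 'm'"
    and P' :: "'m' \<Rightarrow> 'a'"
    and \<phi> :: "'a \<Rightarrow> 'a'"
    and \<psi> :: "'m \<Rightarrow> 'm'"
  shows "(relative_averaging_algebra sA sM l r P \<longrightarrow>
            diassociative_algebra sM (dashv_of r P) (vdash_of l P)) \<and>
         (relative_averaging_morphism sA sM l r P sA' sM' l' r' P' \<phi> \<psi> \<longrightarrow>
            diassociative_morphism sM (dashv_of r P) (vdash_of l P)
              sM' (dashv_of r' P') (vdash_of l' P') \<psi>)"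
  using relative_averaging_algebra.diassociative_algebra_of
    relative_averaging_morphism.diassociative_morphism_of
  by blast

end
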